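(* Let $U$ be a set, $E$ a finite set, and $G=(F,E)$ a covering soft set over $U$, with associated soft covering approximation space $S=(U,C_G)$. Then the following are equivalent: (i) for all $X,Y\subseteq U$, $X\subseteq Y$ implies $S^-(X)\subseteq S^-(Y)$; (ii) for all $e_1,e_2\in E$, the set $F(e_1)\cap F(e_2)$ is a finite union of elements of $C_G$.
   Context: A soft set over $U$ is a pair $G=(F,E)$ with $F:E\to P(U)$ a map into the power set of $U$. It is a covering soft set if $\bigcup_{e\in E}F(e)=U$ and $F(e)\neq\emptyset$ for every $e\in E$. Write $C_G=\{F(e):e\in E\}$; the pair $S=(U,C_G)$ is called a soft covering approximation space. For $x\in U$ the soft minimal description of $x$ is $Md_S(x)=\{F(e): e\in E,\ x\in F(e),\text{ and for all } a\in E,\ x\in F(a)\subseteq F(e)\text{ implies }F(a)=F(e)\}$, i.e. the family of inclusion-minimal members of $C_G$ containing $x$. For $X\subseteq U$ the soft covering lower approximation is $S_-(X)=\bigcup\{F(e): e\in E,\ F(e)\subseteq X\}$ and the soft covering upper approximation is $S^-(X)=S_-(X)\cup\bigcup_{x\in X\setminus S_-(X)}\ \bigcup_{K\in Md_S(x)}K$. The empty union (equal to $\emptyset$) counts as a finite union of elements of $C_G$. *)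

theory Defs
  imports Main "HOL-Library.FuncSet"
begin

(* A soft set (F, E) over U is given by a total function F of which only the values on E matter. *)

definition soft_set :: "'a set \<Rightarrow> ('e \<Rightarrow> 'a set) \<Rightarrow> 'e set \<Rightarrow> bool" where
  "soft_set U F E \<longleftrightarrow> F \<in> E \<rightarrow> Pow U"

definition covering_soft_set :: "'a set \<Rightarrow> ('e \<Rightarrow> 'a set) \<Rightarrow> 'e set \<Rightarrow> bool" where
  "covering_soft_set U F E \<longleftrightarrow>
     soft_set U F E \<and> (\<Union>e\<in>E. F e) = U \<and> (\<forall>e\<in>E. F e \<noteq> {})"

definition soft_cover :: "('e \<Rightarrow> 'a set) \<Rightarrow> 'e set \<Rightarrow> 'a set set" where
  "soft_cover F E = {F e | e. e \<in> E}"

definition soft_minimal_description :: "('e \<Rightarrow> 'a set) \<Rightarrow> 'e set \<Rightarrow> 'a \<Rightarrow> 'a set set" where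
  "soft_minimal_description F E x =
     {F e | e. e \<in> E \<and> x \<in> F e \<and> (\<forall>a\<in>E. x \<in> F a \<and> F a \<subseteq> F e \<longrightarrow> F a = F e)}"

definition soft_lower_approx :: "('e \<Rightarrow> 'a set) \<Rightarrow> 'e set \<Rightarrow> 'a set \<Rightarrow> 'a set" where
  "soft_lower_approx F E X = \<Union>{F e | e. e \<in> E \<and> F e \<subseteq> X}"

definition soft_upper_approx :: "('e \<Rightarrow> 'a set) \<Rightarrow> 'e set \<Rightarrow> 'a set \<Rightarrow> 'a set" where
  "soft_upper_approx F E X =
     soft_lower_approx F E X \<union>
     (\<Union>x \<in> X - soft_lower_approx F E X. \<Union>K \<in> soft_minimal_description F E x. K)"

definition is_finite_union_of :: "'a set set \<Rightarrow> 'a set \<Rightarrow> bool" where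
  "is_finite_union_of C A \<longleftrightarrow> (\<exists>D. finite D \<and> D \<subseteq> C \<and> A = \<Union>D)"

end

theory Submission imports Defs
begin

text \<open>
  Both conditions say that the cover is a base: whenever \<open>x \<in> F e1 \<inter> F e2\<close>, some member of the cover
  contains \<open>x\<close> and lies in \<open>F e1 \<inter> F e2\<close>. Given a base, the minimal members containing \<open>x\<close> lie inside
  every member containing \<open>x\<close>, and monotonicity follows. Conversely, members of the cover are fixed
  by the upper approximation, so monotonicity applied to \<open>{x} \<subseteq> F e\<close> puts every minimal
  member containing \<open>x\<close> inside \<open>F e\<close>, unless \<open>{x}\<close> is itself a member.
\<close>

text \<open>Since \<open>E\<close> is finite, only finitely many members contain \<open>x\<close>,
  so one that is minimal under inclusion lies below \<open>F e\<close>.\<close>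

lemma soft_minimal_description_nonempty:
  assumes "finite E" "e \<in> E" "x \<in> F e"
  obtains K where "K \<in> soft_minimal_description F E x"
proof -
  let ?C = "{F a | a. a \<in> E \<and> x \<in> F a}"
  have "finite ?C" "F e \<in> ?C" using assms by auto
  then have "\<exists>K\<in>?C. K \<subseteq> F e \<and> (\<forall>L\<in>?C. L \<subseteq> K \<longrightarrow> K = L)"
    by (rule finite_has_minimal2)
  then obtain K where K: "K \<in> ?C" and min: "\<forall>L\<in>?C. L \<subseteq> K \<longrightarrow> K = L"
    by (elim bexE conjE)
  obtain a where a: "K = F a" "a \<in> E" "x \<in> F a" using K by blast
  have "F b = F a" if "b \<in> E" "x \<in> F b" "F b \<subseteq> F a" for b
    using bspec[OF min, of "F b"] that a(1) by auto
  then have "F a \<in> soft_minimal_description F E x"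
    unfolding soft_minimal_description_def using a by blast
  then show thesis by (rule that)
qed

lemma soft_lower_approx_member: "e \<in> E \<Longrightarrow> soft_lower_approx F E (F e) = F e"
  unfolding soft_lower_approx_def by blast

text \<open>A member exhausts itself from below, so no point is left over to contribute its minimal
  description.\<close>

lemma soft_upper_approx_member: "e \<in> E \<Longrightarrow> soft_upper_approx F E (F e) = F e"
  unfolding soft_upper_approx_def by (simp add: soft_lower_approx_member)

text \<open>Finiteness of \<open>E\<close> makes every union of members a finite one, so condition
  (ii) becomes the pointwise base condition.\<close>

lemma finite_union_of_soft_cover_iff:
  assumes "finite E"
  shows "is_finite_union_of (soft_cover F E) A \<longleftrightarrow> (\<forall>x\<in>A. \<exists>e\<in>E. x \<in> F e \<and> F e \<subseteq> A)"
proof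
  assume "is_finite_union_of (soft_cover F E) A"
  then show "\<forall>x\<in>A. \<exists>e\<in>E. x \<in> F e \<and> F e \<subseteq> A"
    unfolding is_finite_union_of_def soft_cover_def by blast
next
  assume A: "\<forall>x\<in>A. \<exists>e\<in>E. x \<in> F e \<and> F e \<subseteq> A"
  \<comment> \<open>The largest candidate: all members inside \<open>A\<close>.\<close>
  let ?D = "{F e | e. e \<in> E \<and> F e \<subseteq> A}"
  have "finite ?D" using assms by simp
  moreover have "?D \<subseteq> soft_cover F E" unfolding soft_cover_def by blast
  moreover have "A = \<Union>?D" using A by blast
  ultimately show "is_finite_union_of (soft_cover F E) A"
    unfolding is_finite_union_of_def by blast
qed

lemma soft_upper_approx_mono_if_base:
  assumes base: "\<And>e1 e2 x. \<lbrakk>e1 \<in> E; e2 \<in> E; x \<in> F e1 \<inter> F e2\<rbrakk>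
      \<Longrightarrow> \<exists>e\<in>E. x \<in> F e \<and> F e \<subseteq> F e1 \<inter> F e2"
    and "X \<subseteq> Y"
  shows "soft_upper_approx F E X \<subseteq> soft_upper_approx F E Y"
proof
  fix y assume y: "y \<in> soft_upper_approx F E X"
  show "y \<in> soft_upper_approx F E Y"
  proof (cases "y \<in> soft_lower_approx F E X")
    case True
    then show ?thesis
      using \<open>X \<subseteq> Y\<close> unfolding soft_upper_approx_def soft_lower_approx_def by blast
  next
    case False
    then obtain x K where x: "x \<in> X" and K: "K \<in> soft_minimal_description F E x" "y \<in> K"
      using y unfolding soft_upper_approx_def by blast
    show ?thesis
    \<comment> \<open>The critical case: \<open>x\<close> may enter the lower approximation when
      \<open>X\<close> grows to \<open>Y\<close>. Its minimal description is then no longer added,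
      so \<open>K\<close> has to be absorbed by a member inside \<open>Y\<close>.\<close>
    proof (cases "x \<in> soft_lower_approx F E Y")
      case True
      then obtain e where e: "e \<in> E" "x \<in> F e" "F e \<subseteq> Y"
        unfolding soft_lower_approx_def by blast
      obtain a where a: "K = F a" "a \<in> E" "x \<in> F a"
        "\<And>b. \<lbrakk>b \<in> E; x \<in> F b; F b \<subseteq> F a\<rbrakk> \<Longrightarrow> F b = F a"
        using K(1) unfolding soft_minimal_description_def by blast
      \<comment> \<open>Minimality of \<open>F a\<close> at \<open>x\<close> forces
        \<open>F b = F a\<close>, hence \<open>F a\<close> lies inside \<open>F e\<close>.\<close>
      obtain b where "b \<in> E" "x \<in> F b" "F b \<subseteq> F a \<inter> F e"
        using base[of a e x] a e by blast
      then have "K \<subseteq> F e" using a(1) a(4)[of b] by blast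
      then show ?thesis
        using e K(2) unfolding soft_upper_approx_def soft_lower_approx_def by blast
    next
      case False
      then show ?thesis
        using x K \<open>X \<subseteq> Y\<close> unfolding soft_upper_approx_def by blast
    qed
  qed
qed

lemma base_if_soft_upper_approx_mono:
  assumes "finite E" and cover: "covering_soft_set U F E"
    and mono: "\<And>X Y. \<lbrakk>X \<subseteq> U; Y \<subseteq> U; X \<subseteq> Y\<rbrakk>
      \<Longrightarrow> soft_upper_approx F E X \<subseteq> soft_upper_approx F E Y"
    and e: "e1 \<in> E" "e2 \<in> E" and x: "x \<in> F e1 \<inter> F e2"
  shows "\<exists>e\<in>E. x \<in> F e \<and> F e \<subseteq> F e1 \<inter> F e2"
proof (cases "x \<in> soft_lower_approx F E {x}")
  case True
  \<comment> \<open>Some member contains \<open>x\<close> and lies in \<open>{x}\<close>, so it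
    equals \<open>{x}\<close> and is the member sought.\<close>
  then show ?thesis
    using x unfolding soft_lower_approx_def by blast
next
  case False
  have sub: "soft_upper_approx F E {x} \<subseteq> F a" if "a \<in> E" "x \<in> F a" for a
  proof -
    \<comment> \<open>Monotonicity is available only for subsets of \<open>U\<close>; this bounds
      both \<open>F a\<close> and \<open>{x}\<close>.\<close>
    have "F a \<subseteq> U" using cover \<open>a \<in> E\<close> unfolding covering_soft_set_def by blast
    then show ?thesis
      using mono[of "{x}" "F a"] that by (auto simp: soft_upper_approx_member)
  qed
  obtain K where K: "K \<in> soft_minimal_description F E x"
    using soft_minimal_description_nonempty[of E e1 x F] \<open>finite E\<close> e x by blast
  \<comment> \<open>As \<open>x\<close> is outside the lower approximation of \<open>{x}\<close>,
    all its minimal members enter the upper one.\<close>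
  then have "K \<subseteq> soft_upper_approx F E {x}"
    using False unfolding soft_upper_approx_def by blast
  then have "K \<subseteq> F e1 \<inter> F e2" using sub e x by blast
  moreover obtain a where "a \<in> E" "K = F a" "x \<in> F a"
    using K unfolding soft_minimal_description_def by blast
  ultimately show ?thesis by blast
qed

theorem theorem21:
  fixes U :: "'a set" and E :: "'e set" and F :: "'e \<Rightarrow> 'a set"
  assumes "finite E"
    and "covering_soft_set U F E"
  shows "(\<forall>X Y. X \<subseteq> U \<longrightarrow> Y \<subseteq> U \<longrightarrow> X \<subseteq> Y \<longrightarrow>
            soft_upper_approx F E X \<subseteq> soft_upper_approx F E Y)
     \<longleftrightarrow> (\<forall>e1\<in>E. \<forall>e2\<in>E. is_finite_union_of (soft_cover F E) (F e1 \<inter> F e2))"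
    (is "?mono \<longleftrightarrow> ?unions")
proof
  assume mono: ?mono
  show ?unions
    unfolding finite_union_of_soft_cover_iff[OF \<open>finite E\<close>]
  proof (intro ballI)
    fix e1 e2 x assume "e1 \<in> E" "e2 \<in> E" "x \<in> F e1 \<inter> F e2"
    then show "\<exists>e\<in>E. x \<in> F e \<and> F e \<subseteq> F e1 \<inter> F e2"
      using base_if_soft_upper_approx_mono[OF assms, of e1 e2 x] mono by simp
  qed
next
  assume unions: ?unions
  have base: "\<exists>e\<in>E. x \<in> F e \<and> F e \<subseteq> F e1 \<inter> F e2"
    if "e1 \<in> E" "e2 \<in> E" "x \<in> F e1 \<inter> F e2" for e1 e2 x
    using unions[unfolded finite_union_of_soft_cover_iff[OF \<open>finite E\<close>]] that by (elim ballE) auto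
  show ?mono
    by (intro allI impI soft_upper_approx_mono_if_base[OF base])
qed

end
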